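(* Assume that the minimised objective function $V(a,b)$ is differentiable at $(a^*,b^* )$ (in the sense specified in the context) and, additionally, that the cost functions $C_t$, $1\le t\le T$, are differentiable at the points $P_i$ and $-P_o$. Let $(S^*,\mu^* )$ be the pair described in the context. Then the derivatives of the minimum cost $V^*=V(a^*,b^* )$ of operating the store with respect to variation of the input and output rate constraints $P_i$ and $P_o$ are given respectively by \[ \frac{\partial V^*}{\partial P_i}=\sum_{t\in\tau_i}\bigl(C'_t(P_i)-\mu^*_t\bigr),\qquad \frac{\partial V^*}{\partial P_o}=\sum_{t\in\tau_o}\bigl(\mu^*_t-C'_t(-P_o)\bigr), \] where $\tau_i$ is the set of times $1\le t\le T$ such that $x_t(S^* )=P_i$ and $\tau_o$ is the set of times $1\le t\le T$ such that $x_t(S^* )=-P_o$.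
   Context: Data: an integer $T\ge1$; a capacity $E>0$; rate constraints $P_i>0$ (input) and $P_o>0$ (output); a leakage parameter $\rho$ with $0<\rho\le1$; $X=\{x\in\mathbb{R}:-P_o\le x\le P_i\}$; convex cost functions $C_t:\mathbb{R}\to\mathbb{R}$, $1\le t\le T$; fixed real numbers $S^*_0$, $S^*_T$. For $S=(S_0,\dots,S_T)\in\mathbb{R}^{T+1}$ put $x_t(S)=S_t-\rho S_{t-1}$. Problem $\mathbf{P}$: minimise $\sum_{t=1}^T C_t(x_t(S))$ subject to $S_0=S^*_0$, $S_T=S^*_T$, $0\le S_t\le E$ for $1\le t\le T-1$, and $x_t(S)\in X$ for $1\le t\le T$. $S$ is feasible if it satisfies these constraints; the feasible set is assumed nonempty. Problem $\mathbf{P}(a,b)$, for $a=(a_1,\dots,a_T)$, $b=(b_1,\dots,b_T)$ with $a_t\le b_t$ for all $t$: minimise $\sum_{t=1}^T C_t(x_t(S))$ over $S$ with $S_0=S^*_0$, $a_t\le S_t\le b_t$ and $x_t(S)\in X$ for $1\le t\le T$. $V(a,b)$ denotes the minimum value ($+\infty$ if infeasible). Let $a^*_t=0$, $b^*_t=E$ for $1\le t\le T-1$ and $a^*_T=b^*_T=S^*_T$, so that $\mathbf{P}=\mathbf{P}(a^*,b^* )$, and write $V^*=V(a^*,b^* )$, regarded as a function of $P_i$ (respectively $P_o$), all other data fixed, when differentiating with respect to $P_i$ (respectively $P_o$). Differentiability assumption on $V$: the function $(a_1,\dots,a_{T-1},b_1,\dots,b_{T-1},s)\mapsto V((a_1,\dots,a_{T-1},s),(b_1,\dots,b_{T-1},s))$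 is finite in a neighbourhood of, and differentiable at, the point $a_t=0$, $b_t=E$ ($1\le t\le T-1$), $s=S^*_T$. The pair $(S^*,\mu^* )$, with $S^*=(S^*_0,\dots,S^*_T)$ and $\mu^*=(\mu^*_1,\dots,\mu^*_T)\in\mathbb{R}^T$, satisfies: (i) $S^*$ is feasible for $\mathbf{P}$; (ii) for each $1\le t\le T$, $x_t(S^* )$ minimises $C_t(x)-\mu^*_t x$ over $x\in X$; (iii) for $1\le t\le T-1$: $\rho\mu^*_{t+1}=\mu^*_t$ if $0<S^*_t<E$, $\rho\mu^*_{t+1}\le\mu^*_t$ if $S^*_t=0$, $\rho\mu^*_{t+1}\ge\mu^*_t$ if $S^*_t=E$. Such a pair exists, $S^*$ then solves $\mathbf{P}$, and under the differentiability assumption on $V$ the vector $\mu^*$ is uniquely determined. *)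

theory Defs
  imports "HOL-Analysis.Analysis"
begin

section \<open>The store problem\<close>

text \<open>
  Vectors indexed by times are functions on \<open>nat\<close>. For levels \<open>S\<close> only the components \<open>0, \<dots>, T\<close>
  matter, for all other vectors only the components \<open>1, \<dots>, T\<close>.
\<close>

definition flow :: "real \<Rightarrow> (nat \<Rightarrow> real) \<Rightarrow> nat \<Rightarrow> real" where
  "flow \<rho> S t = S t - \<rho> * S (t - 1)"

definition total_cost :: "nat \<Rightarrow> real \<Rightarrow> (nat \<Rightarrow> real \<Rightarrow> real) \<Rightarrow> (nat \<Rightarrow> real) \<Rightarrow> real" where
  "total_cost T \<rho> C S = (\<Sum>t = 1..T. C t (flow \<rho> S t))"

text \<open>Feasibility for the problem \<open>P\<close>.\<close>

definition feasible ::
  "nat \<Rightarrow> real \<Rightarrow> real \<Rightarrow> real \<Rightarrow> real \<Rightarrow> real \<Rightarrow> real \<Rightarrow> (nat \<Rightarrow> real) \<Rightarrow> bool" where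
  "feasible T E \<rho> Pin Pout S0 ST S \<longleftrightarrow>
     S 0 = S0 \<and> S T = ST \<and>
     (\<forall>t. 1 \<le> t \<and> t \<le> T - 1 \<longrightarrow> 0 \<le> S t \<and> S t \<le> E) \<and>
     (\<forall>t\<in>{1..T}. flow \<rho> S t \<in> {- Pout..Pin})"

text \<open>Feasibility for the problem \<open>P(a, b)\<close>.\<close>

definition feasible_bounds ::
  "nat \<Rightarrow> real \<Rightarrow> real \<Rightarrow> real \<Rightarrow> real \<Rightarrow> (nat \<Rightarrow> real) \<Rightarrow> (nat \<Rightarrow> real) \<Rightarrow> (nat \<Rightarrow> real) \<Rightarrow> bool" where
  "feasible_bounds T \<rho> Pin Pout S0 a b S \<longleftrightarrow>
     S 0 = S0 \<and>
     (\<forall>t\<in>{1..T}. a t \<le> S t \<and> S t \<le> b t \<and> flow \<rho> S t \<in> {- Pout..Pin})"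

text \<open>
  The minimum value, as an extended real: the infimum over the empty set is \<open>\<infinity>\<close>. For convex costs
  the objective is continuous and the feasible set, restricted to the components \<open>0, \<dots>, T\<close>, is
  compact, so that for a feasible problem the infimum is a minimum.
\<close>

definition min_cost ::
  "nat \<Rightarrow> real \<Rightarrow> real \<Rightarrow> real \<Rightarrow> (nat \<Rightarrow> real \<Rightarrow> real) \<Rightarrow> real \<Rightarrow> (nat \<Rightarrow> real) \<Rightarrow> (nat \<Rightarrow> real) \<Rightarrow> ereal" where
  "min_cost T \<rho> Pin Pout C S0 a b =
     (INF S\<in>{S. feasible_bounds T \<rho> Pin Pout S0 a b S}. ereal (total_cost T \<rho> C S))"

definition lower_star :: "nat \<Rightarrow> real \<Rightarrow> nat \<Rightarrow> real" where
  "lower_star T ST t = (if t = T then ST else 0)"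

definition upper_star :: "nat \<Rightarrow> real \<Rightarrow> real \<Rightarrow> nat \<Rightarrow> real" where
  "upper_star T E ST t = (if t = T then ST else E)"

lemma feasible_bounds_star:
  assumes "T \<ge> 1"
  shows "feasible_bounds T \<rho> Pin Pout S0 (lower_star T ST) (upper_star T E ST) S
           \<longleftrightarrow> feasible T E \<rho> Pin Pout S0 ST S"
proof
  assume L: "feasible_bounds T \<rho> Pin Pout S0 (lower_star T ST) (upper_star T E ST) S"
  have "T \<in> {1..T}" using assms by simp
  then have "S T = ST"
    using L unfolding feasible_bounds_def lower_star_def upper_star_def by force
  moreover have "0 \<le> S t \<and> S t \<le> E" if "1 \<le> t \<and> t \<le> T - 1" for t
  proof -
    have "t \<in> {1..T}" "t \<noteq> T" using that by auto
    have "lower_star T ST t \<le> S t \<and> S t \<le> upper_star T E ST t"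
      using L \<open>t \<in> {1..T}\<close> unfolding feasible_bounds_def by blast
    then show ?thesis using \<open>t \<noteq> T\<close> by (simp add: lower_star_def upper_star_def)
  qed
  ultimately show "feasible T E \<rho> Pin Pout S0 ST S"
    using L unfolding feasible_bounds_def feasible_def by simp
next
  assume R: "feasible T E \<rho> Pin Pout S0 ST S"
  have "lower_star T ST t \<le> S t \<and> S t \<le> upper_star T E ST t" if "t \<in> {1..T}" for t
  proof (cases "t = T")
    case False
    then have "1 \<le> t \<and> t \<le> T - 1" using that by auto
    then show ?thesis
      using R False unfolding feasible_def lower_star_def upper_star_def by simp
  qed (use R in \<open>simp add: feasible_def lower_star_def upper_star_def\<close>)
  then show "feasible_bounds T \<rho> Pin Pout S0 (lower_star T ST) (upper_star T E ST) S"
    using R unfolding feasible_bounds_def feasible_def by simp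
qed

definition optimal_pair ::
  "nat \<Rightarrow> real \<Rightarrow> real \<Rightarrow> real \<Rightarrow> real \<Rightarrow> (nat \<Rightarrow> real \<Rightarrow> real) \<Rightarrow> real \<Rightarrow> real
     \<Rightarrow> (nat \<Rightarrow> real) \<Rightarrow> (nat \<Rightarrow> real) \<Rightarrow> bool" where
  "optimal_pair T E \<rho> Pin Pout C S0 ST S \<mu> \<longleftrightarrow>
     feasible T E \<rho> Pin Pout S0 ST S \<and>
     (\<forall>t\<in>{1..T}. is_arg_min (\<lambda>x. C t x - \<mu> t * x) (\<lambda>x. x \<in> {- Pout..Pin}) (flow \<rho> S t)) \<and>
     (\<forall>t. 1 \<le> t \<and> t \<le> T - 1 \<longrightarrow>
        (0 < S t \<and> S t < E \<longrightarrow> \<rho> * \<mu> (t + 1) = \<mu> t) \<and>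
        (S t = 0 \<longrightarrow> \<rho> * \<mu> (t + 1) \<le> \<mu> t) \<and>
        (S t = E \<longrightarrow> \<rho> * \<mu> (t + 1) \<ge> \<mu> t))"


section \<open>Differentiability\<close>

text \<open>
  Frechet differentiability in finitely many real variables, given by a finite index set \<open>I\<close>.
  The library notion needs the number of variables to be fixed by a type; for index sets that are
  enumerated by a finite type the two notions agree (\<open>coord_differentiable_iff\<close> below).
\<close>

definition coord_ball :: "'i set \<Rightarrow> ('i \<Rightarrow> real) \<Rightarrow> real \<Rightarrow> ('i \<Rightarrow> real) set" where
  "coord_ball I z \<delta> = {y. (\<forall>i. i \<notin> I \<longrightarrow> y i = z i) \<and> L2_set (\<lambda>i. y i - z i) I < \<delta>}"

definition coord_differentiable :: "'i set \<Rightarrow> (('i \<Rightarrow> real) \<Rightarrow> real) \<Rightarrow> ('i \<Rightarrow> real) \<Rightarrow> bool" where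
  "coord_differentiable I f z \<longleftrightarrow>
     (\<exists>g. \<forall>\<epsilon>>0. \<exists>\<delta>>0. \<forall>y\<in>coord_ball I z \<delta>.
        \<bar>f y - f z - (\<Sum>i\<in>I. g i * (y i - z i))\<bar> \<le> \<epsilon> * L2_set (\<lambda>i. y i - z i) I)"

lemma coord_differentiable_iff:
  fixes e :: "'n::finite \<Rightarrow> 'i"
  assumes e: "bij_betw e UNIV I"
  defines "emb \<equiv> \<lambda>z u i. if i \<in> I then u $ inv_into UNIV e i else z i"
  shows "coord_differentiable I f z \<longleftrightarrow>
           (\<lambda>u :: real ^ 'n. f (emb z u)) differentiable (at (\<chi> k. z (e k)))"
proof -
  define x :: "real ^ 'n" where "x = (\<chi> k. z (e k))"
  have inj: "inj e" and I: "I = range e" using e by (auto simp: bij_betw_def)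
  have emb_e: "emb z u (e k) = u $ k" for u :: "real ^ 'n" and k
    using inj by (simp add: emb_def I)
  have embx: "emb z x = z"
    using inj by (auto simp: emb_def x_def I fun_eq_iff)
  have norm_eq: "norm (u - x) = L2_set (\<lambda>i. emb z u i - z i) I" for u :: "real ^ 'n"
    using sum.reindex_bij_betw[OF e, of "\<lambda>i. (emb z u i - z i)\<^sup>2"]
    by (simp add: norm_vec_def L2_set_def emb_e x_def)
  have sum_eq: "(\<Sum>i\<in>I. g i * (emb z u i - z i)) = (\<chi> k. g (e k)) \<bullet> (u - x)"
    for g and u :: "real ^ 'n"
    using sum.reindex_bij_betw[OF e, of "\<lambda>i. g i * (emb z u i - z i)"]
    by (simp add: inner_vec_def emb_e x_def)
  have ball: "coord_ball I z \<delta> = emb z ` {u. norm (u - x) < \<delta>}" for \<delta>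
  proof (intro equalityI subsetI)
    fix y assume y: "y \<in> coord_ball I z \<delta>"
    define u :: "real ^ 'n" where "u = (\<chi> k. y (e k))"
    have "emb z u = y" using y inj by (auto simp: emb_def u_def I fun_eq_iff coord_ball_def)
    moreover have "norm (u - x) < \<delta>"
      using y \<open>emb z u = y\<close> by (simp add: norm_eq coord_ball_def)
    ultimately show "y \<in> emb z ` {u. norm (u - x) < \<delta>}" by blast
  next
    fix y assume "y \<in> emb z ` {u. norm (u - x) < \<delta>}"
    then show "y \<in> coord_ball I z \<delta>"
      by (auto simp: coord_ball_def norm_eq) (auto simp: emb_def)
  qed
  have "coord_differentiable I f z \<longleftrightarrow>
     (\<exists>g. \<forall>\<epsilon>>0. \<exists>\<delta>>0. \<forall>u. norm (u - x) < \<delta> \<longrightarrow>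
        \<bar>f (emb z u) - f (emb z x) - (\<chi> k. g (e k)) \<bullet> (u - x)\<bar> \<le> \<epsilon> * norm (u - x))"
    unfolding coord_differentiable_def ball norm_eq sum_eq[symmetric] embx by auto
  also have "\<dots> \<longleftrightarrow> (\<exists>w :: real ^ 'n. \<forall>\<epsilon>>0. \<exists>\<delta>>0. \<forall>u. norm (u - x) < \<delta> \<longrightarrow>
        \<bar>f (emb z u) - f (emb z x) - w \<bullet> (u - x)\<bar> \<le> \<epsilon> * norm (u - x))"
    (is "(\<exists>g. ?P (\<chi> k. g (e k))) \<longleftrightarrow> (\<exists>w. ?P w)")
  proof
    assume "\<exists>w. ?P w"
    then obtain w where w: "?P w" by blast
    have "(\<chi> k. (\<lambda>i. w $ inv_into UNIV e i) (e k)) = w"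
      using inj by (simp add: vec_eq_iff)
    then have "?P (\<chi> k. (\<lambda>i. w $ inv_into UNIV e i) (e k))" using w by (simp only:)
    then show "\<exists>g. ?P (\<chi> k. g (e k))" 
      by (rule exI[where x = "\<lambda>i. w $ inv_into UNIV e i"])
  qed (elim exE, rule exI)
  also have "\<dots> \<longleftrightarrow> (\<exists>D. ((\<lambda>u. f (emb z u)) has_derivative D) (at x))"
  proof
    assume "\<exists>w. ?P w"
    then obtain w where "?P w" by blast
    then have "((\<lambda>u. f (emb z u)) has_derivative (\<lambda>h. w \<bullet> h)) (at x)"
      unfolding has_derivative_at_alt by (auto intro: bounded_linear_inner_right)
    then show "\<exists>D. ((\<lambda>u. f (emb z u)) has_derivative D) (at x)" by blast
  next
    assume "\<exists>D. ((\<lambda>u. f (emb z u)) has_derivative D) (at x)"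
    then obtain D where D: "((\<lambda>u. f (emb z u)) has_derivative D) (at x)" by blast
    then have "linear D" by (rule has_derivative_linear)
    have "D h = (\<Sum>b\<in>Basis. D b *\<^sub>R b) \<bullet> h" for h
    proof -
      have "D h = D (\<Sum>b\<in>Basis. (h \<bullet> b) *\<^sub>R b)" by (simp only: euclidean_representation)
      also have "\<dots> = (\<Sum>b\<in>Basis. (h \<bullet> b) * D b)"
        using \<open>linear D\<close> by (simp add: linear_sum linear_cmul)
      also have "\<dots> = (\<Sum>b\<in>Basis. D b *\<^sub>R b) \<bullet> h"
        unfolding inner_sum_left inner_scaleR_left
        by (intro sum.cong refl) (metis inner_commute mult.commute)
      finally show ?thesis .
    qed
    then have "D = (\<lambda>h. (\<Sum>b\<in>Basis. D b *\<^sub>R b) \<bullet> h)" by blast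
    then have "?P (\<Sum>b\<in>Basis. D b *\<^sub>R b)"
      using D unfolding has_derivative_at_alt by (metis real_norm_def)
    then show "\<exists>w. ?P w" by blast
  qed
  finally show ?thesis by (simp add: differentiable_def x_def)
qed

text \<open>
  The variables \<open>(a\<^sub>1, \<dots>, a\<^sub>T\<^sub>-\<^sub>1, b\<^sub>1, \<dots>, b\<^sub>T\<^sub>-\<^sub>1, s)\<close>: the bounds at time \<open>T\<close> are both equal to \<open>s\<close>.
\<close>

datatype bound_var = Lower nat | Upper nat | Final

definition bound_vars :: "nat \<Rightarrow> bound_var set" where
  "bound_vars T = Lower ` {1..T - 1} \<union> Upper ` {1..T - 1} \<union> {Final}"

definition lower_of :: "nat \<Rightarrow> (bound_var \<Rightarrow> real) \<Rightarrow> nat \<Rightarrow> real" where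
  "lower_of T z t = (if t = T then z Final else z (Lower t))"

definition upper_of :: "nat \<Rightarrow> (bound_var \<Rightarrow> real) \<Rightarrow> nat \<Rightarrow> real" where
  "upper_of T z t = (if t = T then z Final else z (Upper t))"

definition star_point :: "real \<Rightarrow> real \<Rightarrow> bound_var \<Rightarrow> real" where
  "star_point E ST v = (case v of Lower t \<Rightarrow> 0 | Upper t \<Rightarrow> E | Final \<Rightarrow> ST)"

lemma lower_of_star: "lower_of T (star_point E ST) = lower_star T ST"
  and upper_of_star: "upper_of T (star_point E ST) = upper_star T E ST"
  by (auto simp: lower_of_def upper_of_def star_point_def lower_star_def upper_star_def)

definition min_cost_differentiable ::
  "nat \<Rightarrow> real \<Rightarrow> real \<Rightarrow> real \<Rightarrow> real \<Rightarrow> (nat \<Rightarrow> real \<Rightarrow> real) \<Rightarrow> real \<Rightarrow> real \<Rightarrow> bool" where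
  "min_cost_differentiable T E \<rho> Pin Pout C S0 ST \<longleftrightarrow>
     (let V = \<lambda>z. min_cost T \<rho> Pin Pout C S0 (lower_of T z) (upper_of T z) in
       (\<exists>\<delta>>0. \<forall>z\<in>coord_ball (bound_vars T) (star_point E ST) \<delta>. \<bar>V z\<bar> \<noteq> \<infinity>) \<and>
       coord_differentiable (bound_vars T) (\<lambda>z. real_of_ereal (V z)) (star_point E ST))"

text \<open>
  Derivative of an extended real-valued function; finiteness near the point is part of the notion,
  as \<open>real_of_ereal\<close> maps infinite values to 0.
\<close>

definition has_ereal_derivative :: "(real \<Rightarrow> ereal) \<Rightarrow> real \<Rightarrow> real \<Rightarrow> bool" where
  "has_ereal_derivative f D x \<longleftrightarrow>
     (\<forall>\<^sub>F y in nhds x. \<bar>f y\<bar> \<noteq> \<infinity>) \<and> ((\<lambda>y. real_of_ereal (f y)) has_real_derivative D) (at x)"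

end

theory Submission
  imports Defs
begin

text \<open>
  Both formulas are instances of one statement about the interval of rates
  \<open>[- (Pout + \<beta> r), Pin + \<alpha> r]\<close>: the minimum cost, as a function \<open>f\<close> of \<open>r\<close>, has derivative
  \<open>D = (\<Sum>t. c\<^sub>t (C\<^sub>t'(x\<^sub>t) - \<mu>\<^sub>t))\<close> at \<open>0\<close> (\<open>min_cost_rate_derivative\<close>). Here \<open>x\<^sub>t\<close> is the optimal flow
  and \<open>c\<^sub>t\<close> is the speed of the end of the interval at which \<open>x\<^sub>t\<close> sits: \<open>\<alpha>\<close> at the upper end,
  \<open>- \<beta>\<close> at the lower end and \<open>0\<close> in between. The derivative is found by enclosing \<open>f\<close>.

  Below, \<open>f r \<ge> f 0 + D r\<close> holds for every \<open>r\<close>, by Lagrangian duality (\<open>lagrangian_lower_bound\<close>).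
  The conditions on \<open>\<mu>\<close> as time varies say that \<open>(\<Sum>t. \<mu>\<^sub>t x\<^sub>t)\<close> is least among all levels within the
  capacity bounds, so that it remains to minimise each \<open>C\<^sub>t(x) - \<mu>\<^sub>t x\<close> alone over the new
  interval, and convexity bounds that minimum by the tangent at \<open>x\<^sub>t\<close>.

  Above, a plan for the new rates is needed whose cost is \<open>f 0 + D r\<close> to first order. Running every
  flow at a binding rate along with its bound changes the levels by \<open>r u\<close>, where \<open>u\<close> has flow \<open>c\<close>, so
  this is admissible for a plan that fits the level bounds shifted by \<open>- r u\<close>. Here the
  differentiability of \<open>V\<close> enters: along the line \<open>h \<mapsto> - h u\<close> the value \<open>V\<close> is differentiable, and as
  the Lagrangian bound supports it from below its derivative must be \<open>- (\<Sum>t. \<mu>\<^sub>t c\<^sub>t)\<close>. Hence there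
  is a plan for the shifted bounds of nearly that cost (\<open>near_optimal_for_shifted_bounds\<close>), and the
  change of flow by \<open>c\<close> contributes \<open>(\<Sum>t. c\<^sub>t C\<^sub>t'(x\<^sub>t))\<close>.

  Such a plan need not be close to \<open>S\<close>, as optimal plans need not be unique. Therefore it is
  taken for one fixed small \<open>h\<close> and mixed into \<open>S\<close> with a weight \<open>l\<close> that tends to \<open>0\<close>, which serves
  the rates with \<open>r = l h\<close> (\<open>rate_perturbation_upper_bound\<close>): the flows then do converge to \<open>x\<^sub>t\<close>, so
  that no further rate constraint becomes binding and only derivatives of \<open>C\<^sub>t\<close> at \<open>x\<^sub>t\<close> matter.
\<close>

section \<open>Flows\<close>

lemma flow_add: "flow \<rho> (\<lambda>t. R t + S t) t = flow \<rho> R t + flow \<rho> S t"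
  and flow_diff: "flow \<rho> (\<lambda>t. R t - S t) t = flow \<rho> R t - flow \<rho> S t"
  and flow_scale: "flow \<rho> (\<lambda>t. k * S t) t = k * flow \<rho> S t"
  by (simp_all add: flow_def algebra_simps)

primrec levels_of_flow :: "real \<Rightarrow> (nat \<Rightarrow> real) \<Rightarrow> nat \<Rightarrow> real" where
  "levels_of_flow \<rho> c 0 = 0"
| "levels_of_flow \<rho> c (Suc n) = \<rho> * levels_of_flow \<rho> c n + c (Suc n)"

lemma flow_levels_of_flow: "t \<ge> 1 \<Longrightarrow> flow \<rho> (levels_of_flow \<rho> c) t = c t"
  by (cases t) (simp_all add: flow_def)

text \<open>
  The sum ends at \<open>Suc n\<close> so that the last level, which has no successor, stands apart.
\<close>

lemma sum_flow_by_parts: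
  assumes "d 0 = 0"
  shows "(\<Sum>t = 1..Suc n. \<mu> t * flow \<rho> d t)
           = (\<Sum>t = 1..n. (\<mu> t - \<rho> * \<mu> (t + 1)) * d t) + \<mu> (Suc n) * d (Suc n)"
  by (induction n) (simp_all add: assms flow_def algebra_simps)

text \<open>
  Levels that are feasible for the original problem up to the rate constraints, which are the part of
  the problem that is perturbed.
\<close>

definition within_star_bounds ::
  "nat \<Rightarrow> real \<Rightarrow> real \<Rightarrow> real \<Rightarrow> (nat \<Rightarrow> real) \<Rightarrow> bool" where
  "within_star_bounds T E S0 ST S \<longleftrightarrow>
     S 0 = S0 \<and> (\<forall>t\<in>{1..T}. lower_star T ST t \<le> S t \<and> S t \<le> upper_star T E ST t)"

text \<open>
  Complementary slackness: after summation by parts the level difference at time \<open>t\<close> has weight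
  \<open>\<mu>\<^sub>t - \<rho> \<mu>\<^sub>t\<^sub>+\<^sub>1\<close>, whose sign is the one of the difference wherever \<open>S t\<close> is at a capacity bound and
  which vanishes elsewhere. Only levels are compared, so that the inequality also serves problems
  with other rates.
\<close>

lemma multipliers_price_flows:
  assumes "T \<ge> 1" "E > 0"
    and pair: "optimal_pair T E \<rho> Pin Pout C S0 ST S \<mu>"
    and R: "within_star_bounds T E S0 ST R"
  shows "(\<Sum>t = 1..T. \<mu> t * flow \<rho> S t) \<le> (\<Sum>t = 1..T. \<mu> t * flow \<rho> R t)"
proof -
  obtain n where T: "T = Suc n" using \<open>T \<ge> 1\<close> by (cases T) auto
  define d where "d t = R t - S t" for t
  have feas: "feasible T E \<rho> Pin Pout S0 ST S"
    using pair by (simp add: optimal_pair_def)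
  have d0: "d 0 = 0" using R feas by (simp add: d_def within_star_bounds_def feasible_def)
  have "T \<in> {1..T}" using \<open>T \<ge> 1\<close> by simp
  then have "R T = ST"
    using R unfolding within_star_bounds_def lower_star_def upper_star_def by force
  then have dT: "d T = 0" using feas by (simp add: d_def feasible_def)
  have "(\<mu> t - \<rho> * \<mu> (t + 1)) * d t \<ge> 0" if t: "t \<in> {1..n}" for t
  proof -
    have "t \<in> {1..T}" "t \<noteq> T" "1 \<le> t \<and> t \<le> T - 1" using t T by auto
    have "lower_star T ST t \<le> R t" "R t \<le> upper_star T E ST t"
      using R \<open>t \<in> {1..T}\<close> by (auto simp: within_star_bounds_def)
    then have Rt: "0 \<le> R t" "R t \<le> E"
      using \<open>t \<noteq> T\<close> by (simp_all add: lower_star_def upper_star_def)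
    have St: "0 \<le> S t" "S t \<le> E"
      and kkt: "0 < S t \<and> S t < E \<longrightarrow> \<rho> * \<mu> (t + 1) = \<mu> t"
        "S t = 0 \<longrightarrow> \<rho> * \<mu> (t + 1) \<le> \<mu> t" "S t = E \<longrightarrow> \<rho> * \<mu> (t + 1) \<ge> \<mu> t"
      using feas pair \<open>1 \<le> t \<and> t \<le> T - 1\<close> by (auto simp: feasible_def optimal_pair_def)
    consider "S t = 0" | "S t = E" | "0 < S t" "S t < E" using St by linarith
    then show ?thesis
    proof cases
      case 1
      then show ?thesis using kkt Rt by (intro mult_nonneg_nonneg) (auto simp: d_def)
    next
      case 2
      then show ?thesis using kkt Rt by (intro mult_nonpos_nonpos) (auto simp: d_def)
    qed (use kkt in simp)
  qed
  then have "0 \<le> (\<Sum>t = 1..n. (\<mu> t - \<rho> * \<mu> (t + 1)) * d t)" by (rule sum_nonneg)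
  also have "\<dots> = (\<Sum>t = 1..T. \<mu> t * flow \<rho> d t)"
    using sum_flow_by_parts[of d \<mu> \<rho> n] d0 dT by (simp add: T)
  also have "\<dots> = (\<Sum>t = 1..T. \<mu> t * flow \<rho> R t) - (\<Sum>t = 1..T. \<mu> t * flow \<rho> S t)"
    unfolding sum_subtractf[symmetric] d_def flow_diff by (simp add: algebra_simps)
  finally show ?thesis by simp
qed

section \<open>A single time under moving rate constraints\<close>

text \<open>
  The speed of the rate bound at which \<open>x\<close> sits, when the interval of rates is
  \<open>[- (Pout + \<beta> r), Pin + \<alpha> r]\<close> at parameter \<open>r\<close>.
\<close>

definition rate_drift :: "real \<Rightarrow> real \<Rightarrow> real \<Rightarrow> real \<Rightarrow> real \<Rightarrow> real" where
  "rate_drift Pin Pout \<alpha> \<beta> x = (if x = Pin then \<alpha> else if x = - Pout then - \<beta> else 0)"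

lemma convex_above_tangent:
  fixes f :: "real \<Rightarrow> real"
  assumes "convex_on UNIV f" "f differentiable (at x)"
  shows "f x + deriv f x * (y - x) \<le> f y"
  using convex_on_imp_above_tangent[of UNIV f x y "deriv f x"] assms
  by (simp add: DERIV_deriv_iff_real_differentiable)

lemma convex_interior_arg_min:
  fixes f :: "real \<Rightarrow> real"
  assumes "convex_on UNIV f" and "\<And>y. y \<in> {l..u} \<Longrightarrow> f x \<le> f y" and "l < x" "x < u"
  shows "f x \<le> f y"
proof -
  define e where "e = min (x - l) (u - x)"
  have "e > 0" using assms by (simp add: e_def)
  moreover have "\<forall>y\<in>ball x e. f x \<le> f y"
    by (intro ballI assms(2)) (auto simp: e_def dist_real_def)
  ultimately show ?thesis
    using convex_local_global_minimum[of e UNIV f x] assms(1) by auto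
qed

text \<open>
  At an end of the interval the slope of \<open>C x - m x\<close> points outwards downhill, because \<open>x\<close> is
  the minimiser; the tangent there then takes its least value on the new interval at the moved end.
  In the interior the drift vanishes and the minimiser is a global one. The sign of \<open>r\<close> is arbitrary.
\<close>

lemma rate_sensitivity_one_step:
  fixes C :: "real \<Rightarrow> real"
  assumes cvx: "convex_on UNIV C"
    and min: "is_arg_min (\<lambda>x. C x - m * x) (\<lambda>x. x \<in> {- Pout..Pin}) x"
    and lt: "- Pout < Pin"
    and diff: "C differentiable (at Pin)" "C differentiable (at (- Pout))"
    and y: "y \<in> {- (Pout + \<beta> * r)..Pin + \<alpha> * r}"
  shows "C x - m * x + r * (rate_drift Pin Pout \<alpha> \<beta> x * (deriv C x - m)) \<le> C y - m * y"
proof -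
  define g where "g z = C z - m * z" for z
  have x: "x \<in> {- Pout..Pin}" and gmin: "\<And>z. z \<in> {- Pout..Pin} \<Longrightarrow> g x \<le> g z"
    using min by (auto simp: is_arg_min_linorder g_def)
  have der: "(g has_real_derivative deriv C z - m) (at z)" if "C differentiable (at z)" for z
    unfolding g_def
    by (rule derivative_eq_intros DERIV_deriv_iff_real_differentiable[THEN iffD2] that refl | simp)+
  have tangent: "g x + (deriv C x - m) * (y - x) \<le> g y" if "C differentiable (at x)"
    using convex_above_tangent[OF cvx that, of y] by (simp add: g_def algebra_simps)
  consider "x = Pin" | "x = - Pout" | "- Pout < x" "x < Pin" using x by force
  then show ?thesis
  proof cases
    case 1
    have "deriv C x - m \<le> 0"
    proof (rule ccontr)
      assume "\<not> deriv C x - m \<le> 0"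
      then obtain d where d: "d > 0" "\<And>h. 0 < h \<Longrightarrow> h < d \<Longrightarrow> g (x - h) < g x"
        using DERIV_pos_inc_left[OF der] 1 diff by (metis not_le)
      define h where "h = min (d / 2) (Pin + Pout)"
      have "0 < h" "h < d" "x - h \<in> {- Pout..Pin}"
        using d lt 1 by (auto simp: h_def min_def)
      then show False using d gmin by (meson not_le)
    qed
    then have "(deriv C x - m) * (\<alpha> * r) \<le> (deriv C x - m) * (y - x)"
      using y 1 by (intro mult_left_mono_neg) auto
    then show ?thesis using tangent 1 diff by (simp add: g_def rate_drift_def algebra_simps)
  next
    case 2
    have "deriv C x - m \<ge> 0"
    proof (rule ccontr)
      assume "\<not> deriv C x - m \<ge> 0"
      then obtain d where d: "d > 0" "\<And>h. 0 < h \<Longrightarrow> h < d \<Longrightarrow> g (x + h) < g x"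
        using DERIV_neg_dec_right[OF der] 2 diff by (metis not_le)
      define h where "h = min (d / 2) (Pin + Pout)"
      have "0 < h" "h < d" "x + h \<in> {- Pout..Pin}"
        using d lt 2 by (auto simp: h_def min_def)
      then show False using d gmin by (meson not_le)
    qed
    then have "(deriv C x - m) * (- \<beta> * r) \<le> (deriv C x - m) * (y - x)"
      using y 2 by (intro mult_left_mono) auto
    then show ?thesis using tangent 2 diff lt by (simp add: g_def rate_drift_def algebra_simps)
  next
    case 3
    have "convex_on UNIV (\<lambda>z. - m * z)"
      by (intro convex_onI) (auto simp: algebra_simps)
    from convex_on_add[OF cvx this] have "convex_on UNIV g"
      by (simp add: g_def[abs_def])
    from convex_interior_arg_min[OF this gmin 3] show ?thesis
      using 3 by (simp add: g_def rate_drift_def)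
  qed
qed

section \<open>The Lagrangian lower bound\<close>

lemma min_cost_le:
  "feasible_bounds T \<rho> Pin Pout S0 a b S \<Longrightarrow>
     min_cost T \<rho> Pin Pout C S0 a b \<le> ereal (total_cost T \<rho> C S)"
  unfolding min_cost_def by (rule INF_lower) simp

lemma min_cost_ge:
  "(\<And>S. feasible_bounds T \<rho> Pin Pout S0 a b S \<Longrightarrow> k \<le> total_cost T \<rho> C S) \<Longrightarrow>
     ereal k \<le> min_cost T \<rho> Pin Pout C S0 a b"
  unfolding min_cost_def by (rule INF_greatest) simp

text \<open>
  Perturbations of the level bounds (by \<open>- h u\<close>, where \<open>u\<close> has flow \<open>c\<close>) and of the rates (by
  \<open>r\<close>) are allowed together. With \<open>h = 0\<close> the bound supports the minimum cost as a function of the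
  rates, with \<open>r = 0\<close> it identifies the derivative of \<open>V\<close> along a line.
\<close>

lemma lagrangian_lower_bound:
  fixes h r :: real
  assumes "T \<ge> 1" "E > 0" "- Pout < Pin"
    and cvx: "\<forall>t\<in>{1..T}. convex_on UNIV (C t)"
    and diff: "\<forall>t\<in>{1..T}. C t differentiable (at Pin) \<and> C t differentiable (at (- Pout))"
    and pair: "optimal_pair T E \<rho> Pin Pout C S0 ST S \<mu>"
    and R: "within_star_bounds T E S0 ST (\<lambda>t. R t + h * levels_of_flow \<rho> c t)"
    and rates: "\<forall>t\<in>{1..T}. flow \<rho> R t \<in> {- (Pout + \<beta> * r)..Pin + \<alpha> * r}"
  shows "total_cost T \<rho> C S - h * (\<Sum>t = 1..T. \<mu> t * c t)
           + r * (\<Sum>t = 1..T. rate_drift Pin Pout \<alpha> \<beta> (flow \<rho> S t)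
                                * (deriv (C t) (flow \<rho> S t) - \<mu> t))
         \<le> total_cost T \<rho> C R"
proof -
  let ?D = "\<lambda>t. rate_drift Pin Pout \<alpha> \<beta> (flow \<rho> S t) * (deriv (C t) (flow \<rho> S t) - \<mu> t)"
  have "(\<Sum>t = 1..T. \<mu> t * flow \<rho> S t)
      \<le> (\<Sum>t = 1..T. \<mu> t * flow \<rho> (\<lambda>t. R t + h * levels_of_flow \<rho> c t) t)"
    by (rule multipliers_price_flows[OF assms(1,2) pair R])
  also have "\<dots> = (\<Sum>t = 1..T. \<mu> t * flow \<rho> R t + h * (\<mu> t * c t))"
    by (intro sum.cong refl)
      (simp add: flow_add flow_scale flow_levels_of_flow algebra_simps)
  finally have price: "(\<Sum>t = 1..T. \<mu> t * flow \<rho> S t)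
      \<le> (\<Sum>t = 1..T. \<mu> t * flow \<rho> R t) + h * (\<Sum>t = 1..T. \<mu> t * c t)"
    by (simp add: sum.distrib sum_distrib_left)
  have "(\<Sum>t = 1..T. C t (flow \<rho> S t) - \<mu> t * flow \<rho> S t + r * ?D t)
      \<le> (\<Sum>t = 1..T. C t (flow \<rho> R t) - \<mu> t * flow \<rho> R t)"
    using cvx diff pair rates \<open>- Pout < Pin\<close>
    by (intro sum_mono rate_sensitivity_one_step) (auto simp: optimal_pair_def)
  then show ?thesis
    using price
    by (simp add: total_cost_def sum.distrib sum_subtractf sum_distrib_left)
qed

section \<open>Plans for perturbed rates\<close>

text \<open>
  The convex part of the motion, from \<open>x\<close> towards \<open>y\<close>, costs at most the chord, which needs no
  derivative; this matters because the costs may have kinks at flows that are not at a rate bound.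
  Where the drift \<open>c\<close> is present, \<open>C'(x) (y - x) \<le> C y - C x\<close> turns the derivative of the
  combined motion into the same form.
\<close>

lemma convex_drift_upper_bound:
  fixes C :: "real \<Rightarrow> real"
  assumes cvx: "convex_on UNIV C"
    and diff: "c \<noteq> 0 \<Longrightarrow> C differentiable (at x)"
    and "e > 0"
  shows "\<forall>\<^sub>F l in at_right 0.
           C (x + l * (y - x + c)) \<le> C x + l * (C y - C x + c * deriv C x + e)"
proof (cases "c = 0")
  case True
  have "C (x + l * (y - x)) \<le> C x + l * (C y - C x + e)" if "0 < l" "l < 1" for l :: real
  proof -
    have "x + l * (y - x) = (1 - l) *\<^sub>R x + l *\<^sub>R y" by (simp add: algebra_simps)
    then have "C (x + l * (y - x)) \<le> (1 - l) * C x + l * C y"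
      using convex_onD[OF cvx, of l x y] that by simp
    then show ?thesis using \<open>e > 0\<close> that
      by (simp add: algebra_simps) (smt (verit) mult_pos_pos)
  qed
  then show ?thesis
    using True by (auto simp: eventually_at_right_field intro!: exI[of _ 1])
next
  case False
  note C_diff = diff[OF False]
  define k where "k = deriv C x"
  have "((\<lambda>l. C (x + l * (y - x + c))) has_real_derivative k * (y - x + c)) (at 0)"
  proof -
    have "(C has_real_derivative k) (at (x + 0 * (y - x + c)))"
      using C_diff by (simp add: k_def DERIV_deriv_iff_real_differentiable)
    moreover have "((\<lambda>l. x + l * (y - x + c)) has_real_derivative y - x + c) (at 0)"
      by (auto intro!: derivative_eq_intros)
    ultimately show ?thesis by (rule DERIV_chain2)
  qed
  then have "((\<lambda>l. (C (x + l * (y - x + c)) - C x) / l) \<longlongrightarrow> k * (y - x + c)) (at 0)"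
    by (simp add: DERIV_def)
  then have "((\<lambda>l. (C (x + l * (y - x + c)) - C x) / l) \<longlongrightarrow> k * (y - x + c)) (at_right 0)"
    by (rule filterlim_mono) (simp_all add: at_le)
  moreover have "k * (y - x + c) < C y - C x + c * k + e"
    using convex_above_tangent[OF cvx C_diff, of y] \<open>e > 0\<close> by (simp add: k_def algebra_simps)
  ultimately have "\<forall>\<^sub>F l in at_right 0.
      (C (x + l * (y - x + c)) - C x) / l < C y - C x + c * k + e"
    by (rule order_tendstoD)
  moreover have "\<forall>\<^sub>F l in at_right (0::real). l > 0" by (rule eventually_at_right_less)
  ultimately show ?thesis
    by eventually_elim (auto simp: k_def divide_simps mult.commute)
qed

lemma affine_eventually_less:
  fixes a b :: real
  assumes "a < b"
  shows "\<forall>\<^sub>F l in at_right 0. a + l * k < b + l * k'"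
proof -
  have "((\<lambda>l. (b + l * k') - (a + l * k)) \<longlongrightarrow> (b + 0 * k') - (a + 0 * k)) (at_right 0)"
    by (intro tendsto_intros)
  then have "\<forall>\<^sub>F l in at_right 0. 0 < (b + l * k') - (a + l * k)"
    by (rule order_tendstoD) (use assms in simp)
  then show ?thesis by eventually_elim simp
qed

text \<open>
  A bound that is attained at \<open>x\<close> moves exactly with the drift and \<open>y - x\<close> points inwards; a bound that
  is not attained has slack that a small \<open>l\<close> does not exhaust.
\<close>

lemma rate_drift_admissible:
  fixes h \<alpha> \<beta> :: real
  assumes x: "x \<in> {- Pout..Pin}" and y: "y \<in> {- Pout..Pin}" and "- Pout < Pin"
  defines "c \<equiv> rate_drift Pin Pout \<alpha> \<beta> x"
  shows "\<forall>\<^sub>F l in at_right 0.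
           x + l * (y - x + h * c) \<in> {- (Pout + \<beta> * (l * h))..Pin + \<alpha> * (l * h)}"
proof -
  have up: "\<forall>\<^sub>F l in at_right 0. x + l * (y - x + h * c) \<le> Pin + l * (\<alpha> * h)"
  proof (cases "x = Pin")
    case True
    have "l * (y - Pin) \<le> 0" if "l > 0" for l using that y
      by (simp add: mult_le_0_iff)
    then have "x + l * (y - x + h * c) \<le> Pin + l * (\<alpha> * h)" if "l > 0" for l
      using that True by (simp add: c_def rate_drift_def algebra_simps)
    then show ?thesis by (auto intro: eventually_mono[OF eventually_at_right_less])
  next
    case False
    then show ?thesis
      using x by (intro eventually_mono[OF affine_eventually_less
            [of x Pin "y - x + h * c" "\<alpha> * h"]]) auto
  qed
  have low: "\<forall>\<^sub>F l in at_right 0. - Pout + l * (- \<beta> * h) \<le> x + l * (y - x + h * c)"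
  proof (cases "x = - Pout")
    case True
    have "- Pout + l * (- \<beta> * h) \<le> x + l * (y - x + h * c)" if "l > 0" for l
    proof -
      have "l * (y + Pout) \<ge> 0" using that y by (intro mult_nonneg_nonneg) auto
      then show ?thesis
        using True \<open>- Pout < Pin\<close> by (simp add: c_def rate_drift_def algebra_simps)
    qed
    then show ?thesis by (auto intro: eventually_mono[OF eventually_at_right_less])
  next
    case False
    then show ?thesis
      using x by (intro eventually_mono[OF affine_eventually_less
            [of "- Pout" x "- \<beta> * h" "y - x + h * c"]]) auto
  qed
  from up low show ?thesis by eventually_elim (simp add: algebra_simps)
qed

text \<open>
  The plan that witnesses the bound is the convex combination of \<open>S\<close> and \<open>R + h u\<close> with weight \<open>l\<close> on
  the latter. Both satisfy the original level bounds, and its flow is \<open>x + l (y - x + h c)\<close>.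
\<close>

lemma rate_perturbation_upper_bound:
  fixes h e \<alpha> \<beta> :: real
  assumes "T \<ge> 1" "- Pout < Pin"
    and cvx: "\<forall>t\<in>{1..T}. convex_on UNIV (C t)"
    and diff: "\<forall>t\<in>{1..T}. C t differentiable (at Pin) \<and> C t differentiable (at (- Pout))"
    and S: "feasible_bounds T \<rho> Pin Pout S0 (lower_star T ST) (upper_star T E ST) S"
    and R: "\<forall>t\<in>{1..T}. flow \<rho> R t \<in> {- Pout..Pin}"
    and e: "e > 0"
  defines "c \<equiv> \<lambda>t. rate_drift Pin Pout \<alpha> \<beta> (flow \<rho> S t)"
  assumes R': "within_star_bounds T E S0 ST (\<lambda>t. R t + h * levels_of_flow \<rho> c t)"
  shows "\<forall>\<^sub>F l in at_right 0.
           min_cost T \<rho> (Pin + \<alpha> * (l * h)) (Pout + \<beta> * (l * h)) C S0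
               (lower_star T ST) (upper_star T E ST)
           \<le> ereal (total_cost T \<rho> C S
               + l * (total_cost T \<rho> C R - total_cost T \<rho> C S
                        + h * (\<Sum>t = 1..T. c t * deriv (C t) (flow \<rho> S t)) + e))"
proof -
  let ?x = "flow \<rho> S" and ?y = "flow \<rho> R"
  define Q where "Q l t = S t + l * (R t + h * levels_of_flow \<rho> c t - S t)" for l t
  have flow_Q: "flow \<rho> (Q l) t = ?x t + l * (?y t - ?x t + h * c t)" if "t \<in> {1..T}" for l t
    using that flow_levels_of_flow[of t \<rho> c] unfolding Q_def
    by (simp add: flow_add flow_diff flow_scale)
  have Q_levels: "lower_star T ST t \<le> Q l t \<and> Q l t \<le> upper_star T E ST t"
    if l: "0 < l" "l < 1" and t: "t \<in> {1..T}" for l t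
  proof -
    define s r where "s = S t" and "r = R t + h * levels_of_flow \<rho> c t"
    have "s \<in> {lower_star T ST t..upper_star T E ST t}" "r \<in> {lower_star T ST t..upper_star T E ST t}"
      using S R' t by (auto simp: feasible_bounds_def within_star_bounds_def s_def r_def)
    then have "(1 - l) *\<^sub>R s + l *\<^sub>R r \<in> {lower_star T ST t..upper_star T E ST t}"
      using l by (intro convexD) auto
    moreover have "Q l t = (1 - l) *\<^sub>R s + l *\<^sub>R r"
      by (simp add: Q_def s_def r_def algebra_simps)
    ultimately show ?thesis by simp
  qed
  have Q0: "Q l 0 = S0" for l
    using S R' by (simp add: Q_def feasible_bounds_def within_star_bounds_def)
  \<comment> \<open>The error \<open>e\<close> is shared equally among the times.\<close>
  define k where "k t = C t (?y t) - C t (?x t) + h * c t * deriv (C t) (?x t) + e / T" for t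
  have "\<forall>\<^sub>F l in at_right 0. \<forall>t\<in>{1..T}.
      flow \<rho> (Q l) t \<in> {- (Pout + \<beta> * (l * h))..Pin + \<alpha> * (l * h)}"
  proof (intro eventually_ball_finite ballI)
    fix t assume t: "t \<in> {1..T}"
    have "?x t \<in> {- Pout..Pin}" "?y t \<in> {- Pout..Pin}"
      using S R t by (auto simp: feasible_bounds_def)
    from rate_drift_admissible[OF this \<open>- Pout < Pin\<close>]
    show "\<forall>\<^sub>F l in at_right 0.
        flow \<rho> (Q l) t \<in> {- (Pout + \<beta> * (l * h))..Pin + \<alpha> * (l * h)}"
      unfolding flow_Q[OF t] c_def .
  qed simp
  moreover have "\<forall>\<^sub>F l in at_right 0. \<forall>t\<in>{1..T}.
      C t (flow \<rho> (Q l) t) \<le> C t (?x t) + l * k t"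
  proof (intro eventually_ball_finite ballI)
    fix t assume t: "t \<in> {1..T}"
    have "C t differentiable (at (?x t))" if "h * c t \<noteq> 0"
      using that diff t by (auto simp: c_def rate_drift_def split: if_splits)
    from convex_drift_upper_bound[of "C t" "h * c t" "?x t" "e / T" "?y t", OF _ this]
    show "\<forall>\<^sub>F l in at_right 0. C t (flow \<rho> (Q l) t) \<le> C t (?x t) + l * k t"
      using cvx t e \<open>T \<ge> 1\<close> by (simp add: flow_Q k_def)
  qed simp
  moreover have "\<forall>\<^sub>F l in at_right (0::real). 0 < l \<and> l < 1"
    by (auto simp: eventually_at_right_field intro: exI[of _ 1])
  ultimately show ?thesis
  proof eventually_elim
    case (elim l)
    have "feasible_bounds T \<rho> (Pin + \<alpha> * (l * h)) (Pout + \<beta> * (l * h)) S0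
        (lower_star T ST) (upper_star T E ST) (Q l)"
      using elim Q_levels[of l] Q0 by (simp add: feasible_bounds_def)
    then have "min_cost T \<rho> (Pin + \<alpha> * (l * h)) (Pout + \<beta> * (l * h)) C S0
        (lower_star T ST) (upper_star T E ST) \<le> ereal (total_cost T \<rho> C (Q l))"
      by (rule min_cost_le)
    also have "total_cost T \<rho> C (Q l) \<le> (\<Sum>t = 1..T. C t (?x t) + l * k t)"
      unfolding total_cost_def using elim by (intro sum_mono) simp
    also have "\<dots> = total_cost T \<rho> C S + l * (\<Sum>t = 1..T. k t)"
      by (simp add: total_cost_def sum.distrib sum_distrib_left)
    also have "(\<Sum>t = 1..T. k t) = total_cost T \<rho> C R - total_cost T \<rho> C S
        + h * (\<Sum>t = 1..T. c t * deriv (C t) (?x t)) + e"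
      using \<open>T \<ge> 1\<close>
      by (simp add: k_def total_cost_def sum.distrib sum_subtractf sum_distrib_left mult.assoc)
    finally show ?case by simp
  qed
qed

section \<open>Tools for derivatives\<close>

lemma L2_set_scale: "L2_set (\<lambda>i. h * v i) I = \<bar>h\<bar> * L2_set v I"
  by (simp add: L2_set_def power_mult_distrib sum_distrib_left[symmetric] real_sqrt_mult)

lemma coord_differentiable_along_line:
  assumes "finite I" "coord_differentiable I f z" and v: "\<forall>i. i \<notin> I \<longrightarrow> v i = 0"
  shows "\<exists>m. ((\<lambda>h. f (\<lambda>i. z i + h * v i)) has_real_derivative m) (at 0)"
proof -
  obtain g where g: "\<And>\<epsilon>. \<epsilon> > 0 \<Longrightarrow> \<exists>\<delta>>0. \<forall>y\<in>coord_ball I z \<delta>.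
      \<bar>f y - f z - (\<Sum>i\<in>I. g i * (y i - z i))\<bar> \<le> \<epsilon> * L2_set (\<lambda>i. y i - z i) I"
    using assms(2) unfolding coord_differentiable_def by blast
  define L where "L = L2_set v I"
  define m where "m = (\<Sum>i\<in>I. g i * v i)"
  have "L \<ge> 0" by (simp add: L_def)
  have norm: "L2_set (\<lambda>i. h * v i) I = \<bar>h\<bar> * L" for h
    by (simp add: L_def L2_set_scale)
  \<comment> \<open>\<open>L\<close> may be \<open>0\<close>, hence the tolerances are scaled by \<open>L + 1\<close>.\<close>
  have "\<exists>d>0. \<forall>h. norm (h - 0) < d \<longrightarrow>
      norm (f (\<lambda>i. z i + h * v i) - f (\<lambda>i. z i + 0 * v i) - m * (h - 0)) \<le> e * norm (h - 0)"
    if "e > 0" for e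
  proof -
    obtain \<delta> where \<delta>: "\<delta> > 0" "\<And>y. y \<in> coord_ball I z \<delta> \<Longrightarrow>
        \<bar>f y - f z - (\<Sum>i\<in>I. g i * (y i - z i))\<bar> \<le> e / (L + 1) * L2_set (\<lambda>i. y i - z i) I"
      using g[of "e / (L + 1)"] \<open>e > 0\<close> \<open>L \<ge> 0\<close> by (auto simp: divide_pos_pos)
    have "\<bar>f (\<lambda>i. z i + h * v i) - f z - m * h\<bar> \<le> e * \<bar>h\<bar>" if h: "\<bar>h\<bar> < \<delta> / (L + 1)" for h
    proof -
      have "\<bar>h\<bar> * L \<le> \<bar>h\<bar> * (L + 1)" by (simp add: mult_left_mono)
      also have "\<dots> < \<delta>" using h \<open>L \<ge> 0\<close> by (simp add: pos_less_divide_eq)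
      finally have "(\<lambda>i. z i + h * v i) \<in> coord_ball I z \<delta>"
        using v by (simp add: coord_ball_def norm)
      from \<delta>(2)[OF this]
      have "\<bar>f (\<lambda>i. z i + h * v i) - f z - m * h\<bar> \<le> e / (L + 1) * (\<bar>h\<bar> * L)"
        by (simp add: norm m_def sum_distrib_left mult_ac)
      also have "\<dots> \<le> e / (L + 1) * (\<bar>h\<bar> * (L + 1))"
        using \<open>e > 0\<close> \<open>L \<ge> 0\<close> by (intro mult_left_mono) auto
      finally show ?thesis using \<open>L \<ge> 0\<close> by simp
    qed
    then show ?thesis
      using \<delta>(1) \<open>L \<ge> 0\<close> by (intro exI[of _ "\<delta> / (L + 1)"]) (auto simp: divide_pos_pos)
  qed
  then have "((\<lambda>h. f (\<lambda>i. z i + h * v i)) has_real_derivative m) (at 0)"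
    unfolding has_field_derivative_def has_derivative_at_alt
    by (auto intro: bounded_linear_mult_right)
  then show ?thesis ..
qed

lemma coord_ball_along_line:
  assumes "\<delta> > 0" and v: "\<forall>i. i \<notin> I \<longrightarrow> v i = 0"
  shows "\<forall>\<^sub>F h in nhds (0::real). (\<lambda>i. z i + h * v i) \<in> coord_ball I z \<delta>"
proof -
  have "((\<lambda>h. \<bar>h\<bar> * L2_set v I) \<longlongrightarrow> \<bar>0\<bar> * L2_set v I) (nhds 0)"
    by (intro tendsto_intros) (simp add: filterlim_ident)
  then have "\<forall>\<^sub>F h in nhds (0::real). \<bar>h\<bar> * L2_set v I < \<delta>"
    by (rule order_tendstoD) (use assms in simp)
  then show ?thesis
    by eventually_elim (simp add: coord_ball_def L2_set_scale v)
qed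

lemma derivative_eq_slope_of_support:
  fixes f :: "real \<Rightarrow> real"
  assumes "(f has_real_derivative m) (at x)"
    and "\<forall>\<^sub>F y in nhds x. f x + k * (y - x) \<le> f y"
  shows "m = k"
proof -
  obtain d where d: "d > 0" "\<And>y. \<bar>x - y\<bar> < d \<Longrightarrow> f x + k * (y - x) \<le> f y"
    using assms(2) unfolding eventually_nhds_metric
    by (auto simp: dist_real_def abs_minus_commute)
  have "((\<lambda>y. f y - k * (y - x)) has_real_derivative m - k) (at x)"
    by (auto intro!: derivative_eq_intros assms(1))
  then have "m - k = 0"
    by (rule DERIV_local_min[OF _ d(1)]) (use d(2) in \<open>force simp: algebra_simps\<close>)
  then show ?thesis by simp
qed

text \<open>
  The lower bound is an exact supporting line, the upper bound has an error term; together with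
  finiteness, which they imply near \<open>x\<close>, this is differentiability.
\<close>

lemma has_ereal_derivative_squeeze:
  fixes f :: "real \<Rightarrow> ereal"
  assumes val: "f x = ereal v"
    and low: "\<And>r. ereal (v + D * r) \<le> f (x + r)"
    and up: "\<And>e \<sigma>. e > 0 \<Longrightarrow> \<sigma> \<in> {-1, 1} \<Longrightarrow>
      \<forall>\<^sub>F r in at_right 0. f (x + \<sigma> * r) \<le> ereal (v + D * (\<sigma> * r) + e * r)"
  shows "has_ereal_derivative f D x"
proof -
  have up': "\<exists>d>0. \<forall>r. \<bar>r\<bar> < d \<longrightarrow> f (x + r) \<le> ereal (v + D * r + e * \<bar>r\<bar>)" if e: "e > 0" for e
  proof -
    obtain d1 where d1: "d1 > 0"
      "\<And>r. 0 < r \<Longrightarrow> r < d1 \<Longrightarrow> f (x + r) \<le> ereal (v + D * r + e * r)"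
      using up[OF e, of 1] by (auto simp: eventually_at_right_field)
    obtain d2 where d2: "d2 > 0"
      "\<And>r. 0 < r \<Longrightarrow> r < d2 \<Longrightarrow> f (x - r) \<le> ereal (v - D * r + e * r)"
      using up[OF e, of "-1"] by (auto simp: eventually_at_right_field)
    have "f (x + r) \<le> ereal (v + D * r + e * \<bar>r\<bar>)" if "\<bar>r\<bar> < min d1 d2" for r
    proof -
      consider "r = 0" | "r > 0" | "r < 0" by linarith
      then show ?thesis
        using d1(2)[of r] d2(2)[of "- r"] val that by cases auto
    qed
    then show ?thesis using d1 d2 by (intro exI[of _ "min d1 d2"]) auto
  qed
  obtain d where d: "d > 0" "\<And>r. \<bar>r\<bar> < d \<Longrightarrow> f (x + r) \<le> ereal (v + D * r + 1 * \<bar>r\<bar>)"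
    using up'[of 1] by auto
  have fin: "\<bar>f (x + r)\<bar> \<noteq> \<infinity>" if "\<bar>r\<bar> < d" for r
    using d(2)[OF that] low[of r] by (cases "f (x + r)") auto
  have "\<exists>d>0. \<forall>y. norm (y - x) < d \<longrightarrow>
      norm (real_of_ereal (f y) - real_of_ereal (f x) - D * (y - x)) \<le> e * norm (y - x)"
    if e: "e > 0" for e
  proof -
    obtain d' where d': "d' > 0" "\<And>r. \<bar>r\<bar> < d' \<Longrightarrow> f (x + r) \<le> ereal (v + D * r + e * \<bar>r\<bar>)"
      using up'[OF e] by auto
    have "\<bar>real_of_ereal (f y) - v - D * (y - x)\<bar> \<le> e * \<bar>y - x\<bar>" if "\<bar>y - x\<bar> < min d d'" for y
      using fin[of "y - x"] d'(2)[of "y - x"] low[of "y - x"] that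
      by (cases "f y") auto
    then show ?thesis using d d' val by (intro exI[of _ "min d d'"]) auto
  qed
  then have "((\<lambda>y. real_of_ereal (f y)) has_real_derivative D) (at x)"
    unfolding has_field_derivative_def has_derivative_at_alt
    by (auto intro: bounded_linear_mult_right)
  moreover have "\<forall>\<^sub>F y in nhds x. \<bar>f y\<bar> \<noteq> \<infinity>"
    unfolding eventually_nhds_metric
  proof (intro exI[of _ d] conjI allI impI d)
    fix y assume "dist y x < d"
    then show "\<bar>f y\<bar> \<noteq> \<infinity>" using fin[of "y - x"] by (simp add: dist_real_def)
  qed
  ultimately show ?thesis by (simp add: has_ereal_derivative_def)
qed

lemma has_ereal_derivative_translate:
  assumes "has_ereal_derivative (\<lambda>r. f (x + r)) D 0"
  shows "has_ereal_derivative f D x"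
proof -
  have "nhds x = filtermap (\<lambda>r. x + r) (nhds 0)"
    using filtermap_nhds_shift[of "- x" 0] by (simp add: add.commute)
  then have "\<forall>\<^sub>F y in nhds x. \<bar>f y\<bar> \<noteq> \<infinity>"
    using assms by (simp add: has_ereal_derivative_def eventually_filtermap)
  moreover have "((\<lambda>y. real_of_ereal (f y)) has_real_derivative D) (at x)"
    using assms DERIV_shift[of "\<lambda>y. real_of_ereal (f y)" D 0 x]
    by (simp add: has_ereal_derivative_def add.commute)
  ultimately show ?thesis by (simp add: has_ereal_derivative_def)
qed

section \<open>Shifted level bounds\<close>

text \<open>
  The direction in the space of bounds that moves both level bounds at each time \<open>t\<close> by \<open>u t\<close>. It is
  cut off to \<open>0\<close> off the finitely many variables of the problem, as the points of a \<open>coord_ball\<close>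
  agree with its centre there.
\<close>

definition shift_bounds :: "nat \<Rightarrow> (nat \<Rightarrow> real) \<Rightarrow> bound_var \<Rightarrow> real" where
  "shift_bounds T u v =
     (if v \<in> bound_vars T then (case v of Lower t \<Rightarrow> u t | Upper t \<Rightarrow> u t | Final \<Rightarrow> u T) else 0)"

lemma feasible_shift_bounds:
  assumes "feasible_bounds T \<rho> Pin Pout S0
      (lower_of T (\<lambda>v. star_point E ST v + h * shift_bounds T (\<lambda>t. - u t) v))
      (upper_of T (\<lambda>v. star_point E ST v + h * shift_bounds T (\<lambda>t. - u t) v)) R"
    and "u 0 = 0"
  shows "within_star_bounds T E S0 ST (\<lambda>t. R t + h * u t)"
    and "\<forall>t\<in>{1..T}. flow \<rho> R t \<in> {- Pout..Pin}"
proof -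
  have "lower_star T ST t \<le> R t + h * u t \<and> R t + h * u t \<le> upper_star T E ST t"
    if t: "t \<in> {1..T}" for t
  proof (cases "t = T")
    case True
    then show ?thesis
      using assms(1) t
      by (force simp: feasible_bounds_def lower_of_def upper_of_def shift_bounds_def
          bound_vars_def star_point_def lower_star_def upper_star_def)
  next
    case False
    then have "t \<in> {1..T - 1}" using t by auto
    then have "Lower t \<in> bound_vars T" "Upper t \<in> bound_vars T" by (auto simp: bound_vars_def)
    moreover have "lower_of T (\<lambda>v. star_point E ST v + h * shift_bounds T (\<lambda>t. - u t) v) t \<le> R t"
      "R t \<le> upper_of T (\<lambda>v. star_point E ST v + h * shift_bounds T (\<lambda>t. - u t) v) t"
      using assms(1) t by (auto simp: feasible_bounds_def)
    ultimately show ?thesis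
      using False
      by (simp add: lower_of_def upper_of_def shift_bounds_def star_point_def
          lower_star_def upper_star_def)
  qed
  then show "within_star_bounds T E S0 ST (\<lambda>t. R t + h * u t)"
    using assms by (simp add: within_star_bounds_def feasible_bounds_def)
  show "\<forall>t\<in>{1..T}. flow \<rho> R t \<in> {- Pout..Pin}"
    using assms(1) by (simp add: feasible_bounds_def)
qed

text \<open>
  Along the line of bounds shifted by \<open>- h u\<close>, the value \<open>V\<close> is differentiable at \<open>h = 0\<close> by
  assumption and lies above the line of the same value at \<open>h = 0\<close> and slope
  \<open>- (\<Sum>t. \<mu> t * c t)\<close> by the Lagrangian bound, so that this is its derivative. An infimum below the stated bound is undercut by a plan.
\<close>

lemma near_optimal_for_shifted_bounds:
  fixes c :: "nat \<Rightarrow> real"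
  assumes "T \<ge> 1" "E > 0" "- Pout < Pin"
    and cvx: "\<forall>t\<in>{1..T}. convex_on UNIV (C t)"
    and diff: "\<forall>t\<in>{1..T}. C t differentiable (at Pin) \<and> C t differentiable (at (- Pout))"
    and V: "min_cost_differentiable T E \<rho> Pin Pout C S0 ST"
    and pair: "optimal_pair T E \<rho> Pin Pout C S0 ST S \<mu>"
    and "e > 0"
  shows "\<forall>\<^sub>F h in at 0. \<exists>R.
           within_star_bounds T E S0 ST (\<lambda>t. R t + h * levels_of_flow \<rho> c t)
         \<and> (\<forall>t\<in>{1..T}. flow \<rho> R t \<in> {- Pout..Pin})
         \<and> total_cost T \<rho> C R < total_cost T \<rho> C S - h * (\<Sum>t = 1..T. \<mu> t * c t) + e * \<bar>h\<bar>"
proof -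
  let ?V = "\<lambda>z. min_cost T \<rho> Pin Pout C S0 (lower_of T z) (upper_of T z)"
  define u where "u = levels_of_flow \<rho> c"
  define v where "v = shift_bounds T (\<lambda>t. - u t)"
  define z where "z h = (\<lambda>i. star_point E ST i + h * v i)" for h
  define M where "M = (\<Sum>t = 1..T. \<mu> t * c t)"
  have "finite (bound_vars T)" by (simp add: bound_vars_def)
  have v0: "\<forall>i. i \<notin> bound_vars T \<longrightarrow> v i = 0" by (simp add: v_def shift_bounds_def)
  have "u 0 = 0" by (simp add: u_def)
  note shifted = feasible_shift_bounds[where T = T and E = E and ST = ST and u = u,
      folded v_def, folded z_def, OF _ \<open>u 0 = 0\<close>]
  have "coord_differentiable (bound_vars T) (\<lambda>z. real_of_ereal (?V z)) (star_point E ST)"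
    using V unfolding min_cost_differentiable_def Let_def by blast
  from coord_differentiable_along_line[OF \<open>finite (bound_vars T)\<close> this v0]
  obtain m where m: "((\<lambda>h. real_of_ereal (?V (z h))) has_real_derivative m) (at 0)"
    unfolding z_def by (elim exE)
  have "\<exists>\<delta>>0. \<forall>y\<in>coord_ball (bound_vars T) (star_point E ST) \<delta>. \<bar>?V y\<bar> \<noteq> \<infinity>"
    using V unfolding min_cost_differentiable_def Let_def by (rule conjunct1)
  then obtain \<delta> where "\<delta> > 0"
    and \<delta>: "\<forall>y\<in>coord_ball (bound_vars T) (star_point E ST) \<delta>. \<bar>?V y\<bar> \<noteq> \<infinity>"
    by (elim exE conjE)
  have fin: "\<forall>\<^sub>F h in nhds 0. \<bar>?V (z h)\<bar> \<noteq> \<infinity>"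
    using coord_ball_along_line[OF \<open>\<delta> > 0\<close> v0, where z = "star_point E ST"]
    unfolding z_def by eventually_elim (rule \<delta>[rule_format])
  have low: "ereal (total_cost T \<rho> C S - h * M) \<le> ?V (z h)" for h
    unfolding M_def
  proof (rule min_cost_ge)
    fix R assume "feasible_bounds T \<rho> Pin Pout S0 (lower_of T (z h)) (upper_of T (z h)) R"
    from lagrangian_lower_bound[OF assms(1-3) cvx diff pair
        shifted(1)[OF this, unfolded u_def], where r = 0] shifted(2)[OF this]
    show "total_cost T \<rho> C S - h * (\<Sum>t = 1..T. \<mu> t * c t) \<le> total_cost T \<rho> C R" by simp
  qed
  have "feasible T E \<rho> Pin Pout S0 ST S" using pair by (simp add: optimal_pair_def)
  then have "feasible_bounds T \<rho> Pin Pout S0 (lower_of T (z 0)) (upper_of T (z 0)) S"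
    using \<open>T \<ge> 1\<close> by (simp add: z_def lower_of_star upper_of_star feasible_bounds_star)
  from min_cost_le[OF this, of C] low[of 0] have V0: "?V (z 0) = ereal (total_cost T \<rho> C S)"
    by (simp add: antisym)
  have "m = - M"
  proof (rule derivative_eq_slope_of_support[OF m])
    show "\<forall>\<^sub>F h in nhds 0. real_of_ereal (?V (z 0)) + - M * (h - 0) \<le> real_of_ereal (?V (z h))"
      using fin
    proof eventually_elim
      case (elim h)
      then show ?case using low[of h] V0 by (cases "?V (z h)") (auto simp: algebra_simps)
    qed
  qed
  with m have "((\<lambda>h. (real_of_ereal (?V (z h)) - total_cost T \<rho> C S) / h) \<longlongrightarrow> - M) (at 0)"
    by (simp add: DERIV_def V0)
  then have "\<forall>\<^sub>F h in at 0. dist ((real_of_ereal (?V (z h)) - total_cost T \<rho> C S) / h) (- M) < e"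
    using \<open>e > 0\<close> by (rule tendstoD)
  moreover have "\<forall>\<^sub>F h in at 0. \<bar>?V (z h)\<bar> \<noteq> \<infinity>"
    using fin by (simp add: eventually_nhds_conv_at)
  moreover have "\<forall>\<^sub>F h in at (0::real). h \<noteq> 0" by (simp add: eventually_at_filter)
  ultimately show ?thesis
  proof eventually_elim
    case (elim h)
    define w where "w = real_of_ereal (?V (z h))"
    have "(w - total_cost T \<rho> C S) / h + M = (w - total_cost T \<rho> C S + h * M) / h"
      using elim by (simp add: field_simps)
    then have "\<bar>w - total_cost T \<rho> C S + h * M\<bar> / \<bar>h\<bar> < e"
      using elim by (simp add: w_def dist_real_def flip: abs_divide)
    then have "\<bar>w - total_cost T \<rho> C S + h * M\<bar> < e * \<bar>h\<bar>"
      using elim by (simp add: pos_divide_less_eq)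
    then have "w < total_cost T \<rho> C S - h * M + e * \<bar>h\<bar>" by linarith
    moreover have "?V (z h) = ereal w" using elim by (simp add: w_def ereal_real')
    ultimately have "?V (z h) < ereal (total_cost T \<rho> C S - h * M + e * \<bar>h\<bar>)" by simp
    then obtain R where R: "feasible_bounds T \<rho> Pin Pout S0 (lower_of T (z h)) (upper_of T (z h)) R"
      "total_cost T \<rho> C R < total_cost T \<rho> C S - h * M + e * \<bar>h\<bar>"
      unfolding min_cost_def INF_less_iff by auto
    show ?case
      using shifted[OF R(1)] R(2) unfolding u_def M_def by blast
  qed
qed

section \<open>The derivative with respect to the rates\<close>

theorem min_cost_rate_derivative:
  fixes \<alpha> \<beta> :: real
  assumes "T \<ge> 1" "E > 0" "- Pout < Pin"
    and cvx: "\<forall>t\<in>{1..T}. convex_on UNIV (C t)"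
    and diff: "\<forall>t\<in>{1..T}. C t differentiable (at Pin) \<and> C t differentiable (at (- Pout))"
    and V: "min_cost_differentiable T E \<rho> Pin Pout C S0 ST"
    and pair: "optimal_pair T E \<rho> Pin Pout C S0 ST S \<mu>"
  shows "has_ereal_derivative
           (\<lambda>r. min_cost T \<rho> (Pin + \<alpha> * r) (Pout + \<beta> * r) C S0
                  (lower_star T ST) (upper_star T E ST))
           (\<Sum>t = 1..T. rate_drift Pin Pout \<alpha> \<beta> (flow \<rho> S t)
                          * (deriv (C t) (flow \<rho> S t) - \<mu> t)) 0"
    (is "has_ereal_derivative ?f ?D 0")
proof (rule has_ereal_derivative_squeeze)
  define c where "c t = rate_drift Pin Pout \<alpha> \<beta> (flow \<rho> S t)" for t
  define v where "v = total_cost T \<rho> C S"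
  have "feasible T E \<rho> Pin Pout S0 ST S" using pair by (simp add: optimal_pair_def)
  then have S: "feasible_bounds T \<rho> Pin Pout S0 (lower_star T ST) (upper_star T E ST) S"
    using \<open>T \<ge> 1\<close> by (simp add: feasible_bounds_star)
  show low: "ereal (total_cost T \<rho> C S + ?D * r) \<le> ?f (0 + r)" for r
  proof (unfold add_0, rule min_cost_ge)
    fix R assume R: "feasible_bounds T \<rho> (Pin + \<alpha> * r) (Pout + \<beta> * r) S0
        (lower_star T ST) (upper_star T E ST) R"
    then have "within_star_bounds T E S0 ST (\<lambda>t. R t + 0 * levels_of_flow \<rho> c t)"
      by (simp add: within_star_bounds_def feasible_bounds_def)
    from lagrangian_lower_bound[OF assms(1-3) cvx diff pair this] R
    show "total_cost T \<rho> C S + ?D * r \<le> total_cost T \<rho> C R"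
      by (simp add: feasible_bounds_def mult.commute)
  qed
  show "?f 0 = ereal (total_cost T \<rho> C S)"
    using low[of 0] min_cost_le[OF S, of C] by (simp add: antisym)
  \<comment> \<open>Half of \<open>e\<close> pays for the plan \<open>R\<close>, which is found at the fixed shift \<open>\<sigma> * k\<close>, and half for
    the error of the mixture of \<open>R\<close> into \<open>S\<close> with weight \<open>l = r / k\<close>.\<close>
  fix e \<sigma> :: real assume "e > 0" and \<sigma>: "\<sigma> \<in> {-1, 1}"
  have D: "?D = (\<Sum>t = 1..T. c t * deriv (C t) (flow \<rho> S t)) - (\<Sum>t = 1..T. \<mu> t * c t)"
    by (simp add: c_def algebra_simps sum_subtractf)
  have "\<forall>\<^sub>F h in at 0. \<exists>R.
           within_star_bounds T E S0 ST (\<lambda>t. R t + h * levels_of_flow \<rho> c t)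
         \<and> (\<forall>t\<in>{1..T}. flow \<rho> R t \<in> {- Pout..Pin})
         \<and> total_cost T \<rho> C R < v - h * (\<Sum>t = 1..T. \<mu> t * c t) + e / 2 * \<bar>h\<bar>"
    unfolding v_def using \<open>e > 0\<close>
    by (intro near_optimal_for_shifted_bounds[OF assms(1-3) cvx diff V pair]) simp
  then obtain d where "d > 0" and d: "\<And>h. h \<noteq> 0 \<Longrightarrow> \<bar>h\<bar> < d \<Longrightarrow> \<exists>R.
           within_star_bounds T E S0 ST (\<lambda>t. R t + h * levels_of_flow \<rho> c t)
         \<and> (\<forall>t\<in>{1..T}. flow \<rho> R t \<in> {- Pout..Pin})
         \<and> total_cost T \<rho> C R < v - h * (\<Sum>t = 1..T. \<mu> t * c t) + e / 2 * \<bar>h\<bar>"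
    unfolding eventually_at by (auto simp: dist_real_def)
  define k where "k = d / 2"
  have "k > 0" "k < d" "\<bar>\<sigma> * k\<bar> = k" "\<sigma> * k \<noteq> 0" using \<open>d > 0\<close> \<sigma> by (auto simp: k_def)
  then obtain R where R: "within_star_bounds T E S0 ST (\<lambda>t. R t + \<sigma> * k * levels_of_flow \<rho> c t)"
    "\<forall>t\<in>{1..T}. flow \<rho> R t \<in> {- Pout..Pin}"
    "total_cost T \<rho> C R < v - \<sigma> * k * (\<Sum>t = 1..T. \<mu> t * c t) + e / 2 * k"
    using d[of "\<sigma> * k"] by auto
  have "e / 2 * k > 0" using \<open>e > 0\<close> \<open>k > 0\<close> by simp
  have "\<forall>\<^sub>F l in at_right 0. ?f (l * (\<sigma> * k)) \<le> ereal (v + l * (total_cost T \<rho> C R - v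
      + \<sigma> * k * (\<Sum>t = 1..T. c t * deriv (C t) (flow \<rho> S t)) + e / 2 * k))"
    unfolding v_def c_def
    using R(1)[unfolded c_def[abs_def]]
    by (intro rate_perturbation_upper_bound assms S R \<open>e / 2 * k > 0\<close>)
  then obtain b where "b > 0" and b: "\<And>l. 0 < l \<Longrightarrow> l < b \<Longrightarrow>
      ?f (l * (\<sigma> * k)) \<le> ereal (v + l * (total_cost T \<rho> C R - v
      + \<sigma> * k * (\<Sum>t = 1..T. c t * deriv (C t) (flow \<rho> S t)) + e / 2 * k))"
    by (auto simp: eventually_at_right_field)
  have "?f (0 + \<sigma> * r) \<le> ereal (v + ?D * (\<sigma> * r) + e * r)" if r: "0 < r" "r < b * k" for r
  proof -
    define l where "l = r / k"
    have l: "0 < l" "l < b" and rl: "r = l * k"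
      using r \<open>k > 0\<close> by (simp_all add: l_def pos_divide_less_eq)
    have "total_cost T \<rho> C R - v + \<sigma> * k * (\<Sum>t = 1..T. c t * deriv (C t) (flow \<rho> S t)) + e / 2 * k
        \<le> \<sigma> * k * ?D + e * k"
      using R(3) unfolding D by (simp add: algebra_simps)
    then have "l * (total_cost T \<rho> C R - v
        + \<sigma> * k * (\<Sum>t = 1..T. c t * deriv (C t) (flow \<rho> S t)) + e / 2 * k)
        \<le> l * (\<sigma> * k * ?D + e * k)"
      using l by (intro mult_left_mono) auto
    then have "ereal (v + l * (total_cost T \<rho> C R - v
        + \<sigma> * k * (\<Sum>t = 1..T. c t * deriv (C t) (flow \<rho> S t)) + e / 2 * k))
        \<le> ereal (v + ?D * (\<sigma> * r) + e * r)"
      by (simp add: rl algebra_simps)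
    from order_trans[OF b[OF l] this] show ?thesis by (simp add: rl mult_ac)
  qed
  then show "\<forall>\<^sub>F r in at_right 0.
      ?f (0 + \<sigma> * r) \<le> ereal (total_cost T \<rho> C S + ?D * (\<sigma> * r) + e * r)"
    unfolding v_def eventually_at_right_field using \<open>b > 0\<close> \<open>k > 0\<close>
    by (intro exI[of _ "b * k"]) auto
qed

theorem theorem5:
  fixes T :: nat and E Pin Pout \<rho> S0 ST :: real
    and C :: "nat \<Rightarrow> real \<Rightarrow> real"
    and S \<mu> :: "nat \<Rightarrow> real"
  assumes "T \<ge> 1" and "E > 0" and "Pin > 0" and "Pout > 0" and "0 < \<rho>" and "\<rho> \<le> 1"
    and "\<forall>t\<in>{1..T}. convex_on UNIV (C t)"
    and "\<exists>S'. feasible T E \<rho> Pin Pout S0 ST S'"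
    and "min_cost_differentiable T E \<rho> Pin Pout C S0 ST"
    and "\<forall>t\<in>{1..T}. C t differentiable (at Pin) \<and> C t differentiable (at (- Pout))"
    and "optimal_pair T E \<rho> Pin Pout C S0 ST S \<mu>"
  shows "has_ereal_derivative
           (\<lambda>p. min_cost T \<rho> p Pout C S0 (lower_star T ST) (upper_star T E ST))
           (\<Sum>t\<in>{t\<in>{1..T}. flow \<rho> S t = Pin}. deriv (C t) Pin - \<mu> t) Pin
       \<and> has_ereal_derivative
           (\<lambda>p. min_cost T \<rho> Pin p C S0 (lower_star T ST) (upper_star T E ST))
           (\<Sum>t\<in>{t\<in>{1..T}. flow \<rho> S t = - Pout}. \<mu> t - deriv (C t) (- Pout)) Pout"
proof -
  have "- Pout < Pin" using assms(3,4) by simp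
  note deriv = min_cost_rate_derivative[OF assms(1,2) this assms(7,10,9,11)]
  let ?x = "flow \<rho> S"
  have in_sum: "(\<Sum>t = 1..T. rate_drift Pin Pout 1 0 (?x t) * (deriv (C t) (?x t) - \<mu> t))
      = (\<Sum>t\<in>{t\<in>{1..T}. ?x t = Pin}. deriv (C t) Pin - \<mu> t)"
    unfolding sum.inter_filter[OF finite_atLeastAtMost]
    by (intro sum.cong refl) (simp add: rate_drift_def)
  have out_sum: "(\<Sum>t = 1..T. rate_drift Pin Pout 0 1 (?x t) * (deriv (C t) (?x t) - \<mu> t))
      = (\<Sum>t\<in>{t\<in>{1..T}. ?x t = - Pout}. \<mu> t - deriv (C t) (- Pout))"
    unfolding sum.inter_filter[OF finite_atLeastAtMost]
    by (intro sum.cong refl) (use \<open>- Pout < Pin\<close> in \<open>simp add: rate_drift_def\<close>)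
  show ?thesis
    using deriv[of 1 0] deriv[of 0 1] unfolding in_sum out_sum
    by (auto intro!: has_ereal_derivative_translate)
qed

end
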